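(* Let $n\ge 1$ and let $\mathbf{w}$ be a regular snake word of length $n-1$, i.e. $\mathbf{w}=\varepsilon LRLR\cdots$ or $\mathbf{w}=\varepsilon RLRL\cdots$ (letters alternating). Then the $h^*$-polynomial of the order polytope $\mathcal{O}(P(\mathbf{w}))$ is $$h^*(\mathbf{w};z)=\sum_{i=0}^n D(n-i,i)\,z^i,$$ where $D(i,j)$ denotes the Delannoy number.
   Context: Generalized snake words: for $n\ge 0$, a generalized snake word of length $n$ is $\mathbf{w}=w_0w_1\cdots w_n$ where $w_0=\varepsilon$ is the empty letter and $w_i\in\{L,R\}$ for $1\le i\le n$. Generalized snake posets: $P(\mathbf{w})$ is defined recursively. $P(\varepsilon)$ is the poset on $\{0,1,2,3\}$ with cover relations $1\prec 0$, $2\prec 0$, $3\prec 1$, $3\prec 2$. For $n\ge 1$, $P(w_0w_1\cdots w_n)$ is $P(w_0\cdots w_{n-1})\cup\{2n+2,2n+3\}$ with the added cover relations $2n+3\prec 2n+1$, $2n+3\prec 2n+2$, and: $2n+2\prec 2n-1$ if ($n=1$ and $w_1=L$) or ($n\ge2$ and $w_{n-1}w_n\in\{RL,LR\}$); $2n+2\prec 2n$ if ($n=1$ and $w_1=R$) or ($n\ge 2$ and $w_{n-1}w_n\in\{LL,RR\}$). Order polytope: for a finite poset $P$, $\mathcal{O}(P)=\{x\in[0,1]^P: x_i\le x_j \text{ whenever } i<_P j\}\subset\mathbb{R}^P$, a lattice polytope of dimension $|P|$. $h^*$-polynomial: $h^*(\mathbf{w};z)$ is the polynomial defined by $\sum_{t\ge0}|t\,\mathcal{O}(P(\mathbf{w}))\cap\mathbb{Z}^{P(\mathbf{w})}|\,z^t=\dfrac{h^*(\mathbf{w};z)}{(1-z)^{d+1}}$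 with $d=|P(\mathbf{w})|$. Delannoy numbers: $D(m,n)=\sum_{k=0}^{\min(m,n)}\binom{m}{k}\binom{n}{k}2^k$. *)

theory Defs
  imports Complex_Main "HOL-Library.FuncSet" "HOL-Computational_Algebra.Polynomial_FPS"
begin

section \<open>Generalized snake words and posets\<close>

datatype letter = L | R

text \<open>
  The generalized snake word \<open>w\<^sub>0 w\<^sub>1 \<dots> w\<^sub>n\<close>, where \<open>w\<^sub>0\<close> is the empty letter, is represented by the
  list \<open>[w\<^sub>1, \<dots>, w\<^sub>n]\<close>. So its length \<open>n\<close> is the length of the list, and \<open>w\<^sub>i\<close> is \<open>w ! (i - 1)\<close>.
\<close>

type_synonym snake_word = "letter list"

definition regular_snake_word :: "snake_word \<Rightarrow> bool" where
  "regular_snake_word w \<longleftrightarrow>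
     (\<forall>i<length w. w ! i = (if even i then L else R)) \<or>
     (\<forall>i<length w. w ! i = (if even i then R else L))"

function snake_elems :: "snake_word \<Rightarrow> nat set" where
  "snake_elems w =
     (if w = [] then {0, 1, 2, 3}
      else let n = length w in snake_elems (butlast w) \<union> {2*n + 2, 2*n + 3})"
  by auto
termination by (relation "measure length") auto

text \<open>
  A pair \<open>(a, b)\<close> stands for \<open>a \<prec> b\<close>. In the non-empty case, \<open>w ! (n - 1)\<close> is \<open>w\<^sub>n\<close> and
  \<open>w ! (n - 2)\<close> is \<open>w\<^sub>n\<^sub>-\<^sub>1\<close>.
\<close>

function snake_covers :: "snake_word \<Rightarrow> (nat \<times> nat) set" where
  "snake_covers w =
     (if w = [] then {(1, 0), (2, 0), (3, 1), (3, 2)}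
      else let n = length w in
        snake_covers (butlast w)
        \<union> {(2*n + 3, 2*n + 1), (2*n + 3, 2*n + 2)}
        \<union> (if n = 1 \<and> w ! (n - 1) = L \<or>
               n \<ge> 2 \<and> (w ! (n - 2), w ! (n - 1)) \<in> {(R, L), (L, R)}
            then {(2*n + 2, 2*n - 1)} else {})
        \<union> (if n = 1 \<and> w ! (n - 1) = R \<or>
               n \<ge> 2 \<and> (w ! (n - 2), w ! (n - 1)) \<in> {(L, L), (R, R)}
            then {(2*n + 2, 2*n)} else {}))"
  by auto
termination by (relation "measure length") auto

declare snake_elems.simps [simp del] snake_covers.simps [simp del]

definition snake_less :: "snake_word \<Rightarrow> (nat \<times> nat) set" where
  "snake_less w = (snake_covers w)\<^sup>+"

lemma snake_elems_eq: "snake_elems w = {..2 * length w + 3}"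
proof (induction w rule: rev_induct)
  case Nil
  show ?case by (subst snake_elems.simps) (simp add: atMost_Suc insert_commute eval_nat_numeral)
next
  case (snoc x w)
  have "snake_elems (w @ [x]) = snake_elems w \<union> {2 * length w + 4, 2 * length w + 5}"
    by (subst snake_elems.simps) (simp add: Let_def eval_nat_numeral)
  also have "\<dots> = {..Suc (Suc (2 * length w + 3))}"
    unfolding snoc.IH atMost_Suc by (simp add: insert_commute add.commute)
  also have "Suc (Suc (2 * length w + 3)) = 2 * length (w @ [x]) + 3"
    by simp
  finally show ?case .
qed

lemma snake_covers_subset:
  "snake_covers w \<subseteq> {(a, b). b < a \<and> a \<le> 2 * length w + 3}"
proof (induction w rule: rev_induct)
  case Nil
  show ?case by (subst snake_covers.simps) auto
next
  case (snoc x w)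
  let ?n = "length w + 1"
  have "snake_covers (w @ [x]) \<subseteq> snake_covers w \<union>
      {(2 * ?n + 3, 2 * ?n + 1), (2 * ?n + 3, 2 * ?n + 2), (2 * ?n + 2, 2 * ?n - 1), (2 * ?n + 2, 2 * ?n)}"
    by (subst snake_covers.simps) (simp add: Let_def subset_iff del: insert_iff, blast)
  also have "\<dots> \<subseteq> {(a, b). b < a \<and> a \<le> 2 * length (w @ [x]) + 3}"
    using snoc by fastforce
  finally show ?case .
qed

lemma snake_less_subset:
  "snake_less w \<subseteq> {(a, b). b < a \<and> a \<in> snake_elems w \<and> b \<in> snake_elems w}"
proof -
  have "b < a \<and> a \<le> 2 * length w + 3" if "(a, b) \<in> (snake_covers w)\<^sup>+" for a b
    using that
  proof (induction rule: trancl_induct)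
    case (base y)
    then show ?case using snake_covers_subset by blast
  next
    case (step y z)
    then show ?case using snake_covers_subset by fastforce
  qed
  then show ?thesis by (fastforce simp: snake_less_def snake_elems_eq)
qed

lemma snake_less_strict_order: "irrefl (snake_less w)" "trans (snake_less w)"
  using snake_less_subset by (auto simp: irrefl_def snake_less_def)


section \<open>Order polytopes and their \<open>h\<^sup>*\<close>-polynomials\<close>

text \<open>
  For a finite set \<open>A\<close>, a point of \<open>\<real>\<^sup>A\<close> is a function \<open>nat \<Rightarrow> real\<close> that is \<open>undefined\<close>
  outside \<open>A\<close>, so that distinct functions are distinct points.
\<close>

definition order_polytope :: "nat set \<Rightarrow> (nat \<times> nat) set \<Rightarrow> (nat \<Rightarrow> real) set" where
  "order_polytope A lt =
     {x \<in> A \<rightarrow>\<^sub>E {0..1}. \<forall>i\<in>A. \<forall>j\<in>A. (i, j) \<in> lt \<longrightarrow> x i \<le> x j}"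

definition dilate :: "nat set \<Rightarrow> nat \<Rightarrow> (nat \<Rightarrow> real) set \<Rightarrow> (nat \<Rightarrow> real) set" where
  "dilate A t K = (\<lambda>x. \<lambda>i\<in>A. of_nat t * x i) ` K"

definition ehrhart_series :: "nat set \<Rightarrow> (nat \<Rightarrow> real) set \<Rightarrow> real fps" where
  "ehrhart_series A K = Abs_fps (\<lambda>t. of_nat (card (dilate A t K \<inter> (A \<rightarrow>\<^sub>E \<int>))))"

definition h_star :: "snake_word \<Rightarrow> real poly" where
  "h_star w =
     (THE h. ehrhart_series (snake_elems w) (order_polytope (snake_elems w) (snake_less w)) =
        fps_of_poly h / (1 - fps_X) ^ (card (snake_elems w) + 1))"


section \<open>Delannoy numbers\<close>

definition delannoy :: "nat \<Rightarrow> nat \<Rightarrow> nat" where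
  "delannoy m n = (\<Sum>k = 0..min m n. (m choose k) * (n choose k) * 2 ^ k)"

end

theory Submission
  imports Defs
begin

text \<open>
  The poset of a regular snake word of length \<open>n - 1\<close> is a ladder: it consists of a chain
  \<open>c\<^sub>0 \<succ> c\<^sub>1 \<succ> \<dots> \<succ> c\<^sub>n\<^sub>+\<^sub>1\<close> and of \<open>n\<close> further elements \<open>e\<^sub>1, \<dots>, e\<^sub>n\<close>, where the only relations of
  \<open>e\<^sub>k\<close> are \<open>c\<^sub>k\<^sub>-\<^sub>1 \<succ> e\<^sub>k \<succ> c\<^sub>k\<^sub>+\<^sub>1\<close> and what follows from them. Once the values on the chain are chosen,
  the \<open>e\<^sub>k\<close> are therefore independent of each other, and the lattice points of a dilate can be
  counted along the chain with a finite amount of memory.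

  Subtracting from \<open>t\<close> turns the lattice points of the \<open>t\<close>-th dilate into order-reversing maps
  \<open>g\<close> into the natural numbers with all values at most \<open>t\<close>. Then \<open>t\<close> bounds only the largest
  value, which is taken at the end \<open>c\<^sub>n\<^sub>+\<^sub>1\<close> where the ladder grows. Let \<open>M\<^sub>n(u, v)\<close> be the number
  of such maps, without the bound, that take the values \<open>u\<close> and \<open>v\<close> at \<open>c\<^sub>n\<close> and \<open>c\<^sub>n\<^sub>+\<^sub>1\<close>. A
  new rung has the end value \<open>w \<ge> v\<close> and leaves \<open>w - u + 1\<close> choices for the new \<open>e\<close>, so
  \<open>M\<^sub>n\<^sub>+\<^sub>1(v, w) = (\<Sum>u\<le>v. M\<^sub>n(u, v) (w - u + 1))\<close> (lemma \<open>card_fibre\<close>).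

  The weight \<open>w - u + 1 = (w - v + 1) + (v - u)\<close> depends on \<open>u\<close> only through the gap \<open>v - u\<close>, and
  linearly. Hence two power series suffice, \<open>A\<^sub>n\<close> with coefficients \<open>\<Sum>u. M\<^sub>n(u, v)\<close> and \<open>B\<^sub>n\<close>
  with coefficients \<open>\<Sum>u. (v - u) M\<^sub>n(u, v)\<close>. With \<open>s = 1 / (1 - z)\<close> they satisfy
  \<open>A\<^sub>n\<^sub>+\<^sub>1 = s\<^sup>2 A\<^sub>n + s B\<^sub>n\<close> and \<open>B\<^sub>n\<^sub>+\<^sub>1 = 2 z s\<^sup>3 A\<^sub>n + z s\<^sup>2 B\<^sub>n\<close>. Eliminating \<open>B\<^sub>n\<close> shows that the
  numerators of \<open>A\<^sub>n\<close> obey \<open>H\<^sub>n\<^sub>+\<^sub>2 = (1 + z) H\<^sub>n\<^sub>+\<^sub>1 + z H\<^sub>n\<close>, which is the recurrence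
  \<open>D(i + 1, j + 1) = D(i, j + 1) + D(i + 1, j) + D(i, j)\<close> of the Delannoy numbers along
  antidiagonals (lemma \<open>fibre_gap_series_eq\<close>). Summing over the end value \<open>v \<le> t\<close> multiplies
  \<open>A\<^sub>n\<close> by one more factor \<open>s\<close> and gives the Ehrhart series.
\<close>

section \<open>Delannoy numbers\<close>

text \<open>
  A summation range common to several pairs of arguments lets Pascal's rule be applied to the sums
  term by term.
\<close>

lemma delannoy_eq_sum:
  assumes "min m n \<le> K"
  shows "delannoy m n = (\<Sum>k\<le>K. (m choose k) * (n choose k) * 2 ^ k)"
  unfolding delannoy_def using assms
  by (intro sum.mono_neutral_left) (auto simp: not_le)

lemma delannoy_0_right [simp]: "delannoy m 0 = 1"
  by (simp add: delannoy_def)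

lemma delannoy_0_left [simp]: "delannoy 0 n = 1"
  by (simp add: delannoy_def)

text \<open>
  Pascal's rule is applied to one argument at a time. Raising \<open>m\<close> adds the mixed sum
  \<open>P m n\<close>, whose second binomial coefficient has its lower index shifted by one; raising \<open>n\<close> in
  \<open>P m n\<close> adds \<open>2 * delannoy m n\<close>, the factor 2 coming from the shifted power of 2. Eliminating
  \<open>P\<close> leaves the three-term recurrence.
\<close>

lemma delannoy_rec:
  "delannoy (Suc m) (Suc n) = delannoy m (Suc n) + delannoy (Suc m) n + delannoy m n"
proof -
  define K where "K = m + n + 1"
  define P where "P = (\<lambda>m n. \<Sum>k\<le>K. (m choose k) * (n choose Suc k) * 2 ^ Suc k)"
  have D: "delannoy a b = (\<Sum>k\<le>Suc K. (a choose k) * (b choose k) * 2 ^ k)"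
    if "min a b \<le> Suc K" for a b
    using that by (rule delannoy_eq_sum)
  have raise_left: "delannoy (Suc m) b = delannoy m b + P m b" if "b \<le> Suc n" for b
    using that
    by (simp add: D K_def P_def sum.atMost_Suc_shift algebra_simps flip: sum.distrib
             del: sum.atMost_Suc)
  have raise_right: "P m (Suc n) = 2 * delannoy m n + P m n"
    by (simp add: P_def delannoy_eq_sum[of m n K] K_def sum_distrib_left sum.distrib
          algebra_simps del: sum.atMost_Suc)
  show ?thesis
    using raise_left[of n] raise_left[of "Suc n"] raise_right by simp
qed

definition delannoy_poly :: "nat \<Rightarrow> real poly" where
  "delannoy_poly n = (\<Sum>i = 0..n. monom (of_nat (delannoy (n - i) i)) i)"

lemma coeff_delannoy_poly:
  "coeff (delannoy_poly n) i = (if i \<le> n then of_nat (delannoy (n - i) i) else 0)"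
  by (simp add: delannoy_poly_def coeff_sum)

lemma delannoy_poly_0: "delannoy_poly 0 = 1"
  by (rule poly_eqI) (simp add: coeff_delannoy_poly)

lemma delannoy_poly_1: "delannoy_poly (Suc 0) = [:1, 1:]"
  by (rule poly_eqI) (auto simp: coeff_delannoy_poly coeff_pCons le_Suc_eq split: nat.splits)

text \<open>
  Multiplication by the variable moves along an antidiagonal, so the three-term recurrence of the
  Delannoy numbers becomes a recurrence of order two for the antidiagonal polynomials.
\<close>

lemma delannoy_poly_rec:
  "delannoy_poly (Suc (Suc n)) = [:1, 1:] * delannoy_poly (Suc n) + [:0, 1:] * delannoy_poly n"
proof (rule poly_eqI)
  fix i
  show "coeff (delannoy_poly (Suc (Suc n))) i =
    coeff ([:1, 1:] * delannoy_poly (Suc n) + [:0, 1:] * delannoy_poly n) i"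
  proof (cases i)
    case 0
    then show ?thesis by (simp add: coeff_delannoy_poly)
  next
    case (Suc j)
    consider "j \<le> n" | "j = Suc n" | "j > Suc n" by linarith
    then show ?thesis
    proof cases
      case 1
      then have "Suc n - j = Suc (n - j)" by simp
      with 1 Suc show ?thesis by (simp add: coeff_delannoy_poly delannoy_rec)
    qed (use Suc in \<open>simp_all add: coeff_delannoy_poly\<close>)
  qed
qed


section \<open>Ladders\<close>

text \<open>
  A pair \<open>(a, b)\<close> of the relation means that \<open>a\<close> lies below \<open>b\<close>. The last two arguments are the
  two lowest elements \<open>c\<^sub>n\<close> and \<open>c\<^sub>n\<^sub>+\<^sub>1\<close> of the chain. They are what a new rung is attached to: its
  end \<open>c\<close> lies below \<open>q\<close>, and its free element \<open>e\<close> lies between \<open>p\<close> and \<open>c\<close>. The labels are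
  arbitrary, so that the two regular words, which differ by exchanging 1 and 2, yield the same
  object.
\<close>

inductive ladder :: "nat \<Rightarrow> 'a set \<Rightarrow> ('a \<times> 'a) set \<Rightarrow> 'a \<Rightarrow> 'a \<Rightarrow> bool" where
  rail: "a \<noteq> b \<Longrightarrow> ladder 0 {a, b} {(b, a)} a b"
| rung: "ladder n E C p q \<Longrightarrow> e \<notin> E \<Longrightarrow> c \<notin> E \<Longrightarrow> e \<noteq> c \<Longrightarrow>
    ladder (Suc n) (insert c (insert e E)) (insert (c, q) (insert (c, e) (insert (e, p) C))) q c"

lemma ladder_basic:
  assumes "ladder n E C p q"
  shows "finite E" "C \<subseteq> E \<times> E" "p \<in> E" "q \<in> E" "(q, p) \<in> C" "card E = 2 * n + 2"
  using assms by (induction rule: ladder.induct) auto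

definition antitone_maps :: "'a set \<Rightarrow> ('a \<times> 'a) set \<Rightarrow> ('a \<Rightarrow> nat) set" where
  "antitone_maps E C = {g \<in> E \<rightarrow>\<^sub>E UNIV. \<forall>(a, b)\<in>C. g b \<le> g a}"

lemma antitone_mapsI:
  assumes "g \<in> extensional E" and "\<And>a b. (a, b) \<in> C \<Longrightarrow> g b \<le> g a"
  shows "g \<in> antitone_maps E C"
  using assms by (auto simp: antitone_maps_def PiE_iff)

text \<open>
  The end of the chain is the least element of a ladder. This is why bounding all values of an
  order-reversing map by \<open>t\<close> amounts to bounding the last one.
\<close>

lemma antitone_maps_le_last:
  assumes "ladder n E C p q" "\<forall>(a, b)\<in>C. g b \<le> (g a :: nat)" "i \<in> E"
  shows "g i \<le> g q"
  using assms
proof (induction arbitrary: i rule: ladder.induct)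
  case (rung n E C p q e c)
  have "g q \<le> g c" "g e \<le> g c" "\<And>j. j \<in> E \<Longrightarrow> g j \<le> g q"
    using rung by auto
  then show ?case using rung.prems le_trans by blast
qed auto

definition fibre ::
    "'a set \<Rightarrow> ('a \<times> 'a) set \<Rightarrow> 'a \<Rightarrow> 'a \<Rightarrow> nat \<Rightarrow> nat \<Rightarrow> ('a \<Rightarrow> nat) set" where
  "fibre E C p q u v = {g \<in> antitone_maps E C. g p = u \<and> g q = v}"

lemma finite_antitone_maps_bounded:
  assumes "ladder n E C p q"
  shows "finite {g \<in> antitone_maps E C. g q \<le> t}"
proof (rule finite_subset)
  show "{g \<in> antitone_maps E C. g q \<le> t} \<subseteq> E \<rightarrow>\<^sub>E {..t}"
  proof
    fix g assume g: "g \<in> {g \<in> antitone_maps E C. g q \<le> t}"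
    then have "g i \<le> t" if "i \<in> E" for i
      using antitone_maps_le_last[OF assms _ that, of g] by (simp add: antitone_maps_def)
    with g show "g \<in> E \<rightarrow>\<^sub>E {..t}"
      by (simp add: antitone_maps_def PiE_iff)
  qed
qed (use ladder_basic[OF assms] in \<open>simp add: finite_PiE\<close>)

lemma finite_fibre:
  assumes "ladder n E C p q"
  shows "finite (fibre E C p q u v)"
  by (rule finite_subset[OF _ finite_antitone_maps_bounded[OF assms, of v]])
     (auto simp: fibre_def)

lemma fibre_empty:
  assumes "ladder n E C p q" "v < u"
  shows "fibre E C p q u v = {}"
  using ladder_basic(5)[OF assms(1)] assms(2) by (force simp: fibre_def antitone_maps_def)

fun fibre_card :: "nat \<Rightarrow> nat \<Rightarrow> nat \<Rightarrow> nat" where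
  "fibre_card 0 u v = (if u \<le> v then 1 else 0)"
| "fibre_card (Suc n) v w = (if v \<le> w then \<Sum>u\<le>v. fibre_card n u v * (w + 1 - u) else 0)"

text \<open>
  A new rung interacts with the older elements only through \<open>p\<close> and \<open>q\<close>: if they carry \<open>u\<close> and
  \<open>v\<close>, the new end may carry any \<open>w \<ge> v\<close>, and then the new free element any \<open>x\<close> with
  \<open>u \<le> x \<le> w\<close>.
\<close>

lemma bij_betw_fibre_rung:
  assumes lad: "ladder n E C p q" and new: "e \<notin> E" "c \<notin> E" "e \<noteq> c" and "v \<le> w"
  shows "bij_betw (\<lambda>(u, g, x). g(e := x, c := w))
     (SIGMA u:{..v}. fibre E C p q u v \<times> {u..w})
     (fibre (insert c (insert e E)) (insert (c, q) (insert (c, e) (insert (e, p) C))) q c v w)"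
    (is "bij_betw ?f ?S (fibre ?E ?C q c v w)")
proof (rule bij_betw_byWitness[where f' = "\<lambda>h. (h p, restrict h E, h e)"])
  note basic = ladder_basic[OF lad]
  have off: "p \<noteq> e" "p \<noteq> c" "q \<noteq> e" "q \<noteq> c" using basic(3,4) new by auto
  have CE: "a \<in> E" "b \<in> E" if "(a, b) \<in> C" for a b using that basic(2) by auto
  have CN: "a \<noteq> e \<and> a \<noteq> c \<and> b \<noteq> e \<and> b \<noteq> c" if "(a, b) \<in> C" for a b
    using CE[OF that] new by auto
  show "\<forall>s\<in>?S. (\<lambda>h. (h p, restrict h E, h e)) (?f s) = s"
  proof
    fix s assume "s \<in> ?S"
    then obtain u g x where s: "s = (u, g, x)" and g: "g \<in> fibre E C p q u v"
      by auto
    have "restrict (g(e := x, c := w)) E = g"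
      using g new by (auto simp: fibre_def antitone_maps_def fun_eq_iff PiE_iff extensional_def)
    then show "(\<lambda>h. (h p, restrict h E, h e)) (?f s) = s"
      using g off new by (simp add: s fibre_def)
  qed
  show "\<forall>h\<in>fibre ?E ?C q c v w. ?f (h p, restrict h E, h e) = h"
  proof
    fix h assume h: "h \<in> fibre ?E ?C q c v w"
    then have "h c = w" "h \<in> extensional ?E"
      by (simp_all add: fibre_def antitone_maps_def PiE_iff)
    then have "((restrict h E)(e := h e, c := w)) i = h i" for i
      using extensional_arb[of h ?E i] by auto
    then show "?f (h p, restrict h E, h e) = h"
      by (simp add: fun_eq_iff)
  qed
  show "?f ` ?S \<subseteq> fibre ?E ?C q c v w"
  proof
    fix h assume "h \<in> ?f ` ?S"
    then obtain u g x where h: "h = g(e := x, c := w)" and g: "g \<in> fibre E C p q u v"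
      and x: "u \<le> x" "x \<le> w"
      by auto
    have "h b \<le> h a" if "(a, b) \<in> C" for a b
      using that CN[OF that] g by (auto simp: h fibre_def antitone_maps_def)
    moreover have "h \<in> extensional ?E"
      using g by (auto simp: h fibre_def antitone_maps_def PiE_iff extensional_def)
    moreover have "h p = u" "h q = v" "h e = x" "h c = w"
      using g off new by (auto simp: h fibre_def)
    ultimately show "h \<in> fibre ?E ?C q c v w"
      using x \<open>v \<le> w\<close> by (auto simp: fibre_def antitone_maps_def PiE_iff)
  qed
  show "(\<lambda>h. (h p, restrict h E, h e)) ` fibre ?E ?C q c v w \<subseteq> ?S"
  proof
    fix s assume "s \<in> (\<lambda>h. (h p, restrict h E, h e)) ` fibre ?E ?C q c v w"
    then obtain h where s: "s = (h p, restrict h E, h e)" and h: "h \<in> fibre ?E ?C q c v w"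
      by blast
    have le: "h b \<le> h a" if "(a, b) \<in> ?C" for a b
      using that h unfolding fibre_def antitone_maps_def by blast
    have "restrict h E b \<le> restrict h E a" if "(a, b) \<in> C" for a b
      using that CE[OF that] le[of a b] by simp
    then have "restrict h E \<in> antitone_maps E C"
      by (intro antitone_mapsI) auto
    then have "restrict h E \<in> fibre E C p q (h p) v"
      using h basic(3,4) by (simp add: fibre_def)
    moreover have "h p \<le> v" "h p \<le> h e" "h e \<le> w"
      using h le[of q p] le[of e p] le[of c e] basic(5) by (auto simp: fibre_def)
    ultimately show "s \<in> ?S" by (simp add: s)
  qed
qed

lemma card_fibre:
  assumes "ladder n E C p q"
  shows "card (fibre E C p q u v) = fibre_card n u v"
  using assms
proof (induction arbitrary: u v rule: ladder.induct)
  case (rail a b)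
  have "fibre {a, b} {(b, a)} a b u v =
      (if u \<le> v then {(\<lambda>_. undefined)(a := u, b := v)} else {})"
    using rail by (auto simp: fibre_def antitone_maps_def PiE_iff extensional_def fun_eq_iff)
  then show ?case by simp
next
  case (rung n E C p q e c)
  note ladder = ladder.rung[OF rung.hyps]
  show ?case
  proof (cases "u \<le> v")
    case True
    show ?thesis
      unfolding bij_betw_same_card[OF bij_betw_fibre_rung[OF rung.hyps True], symmetric]
      using True
      by (simp add: card_SigmaI finite_fibre[OF rung.hyps(1)] card_cartesian_product rung.IH
           del: mult_Suc_right)
  qed (use fibre_empty[OF ladder] in simp)
qed

lemma card_antitone_maps_bounded:
  assumes "ladder n E C p q"
  shows "card {g \<in> antitone_maps E C. g q \<le> t} = (\<Sum>v\<le>t. \<Sum>u\<le>v. fibre_card n u v)"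
proof -
  have "{g \<in> antitone_maps E C. g q \<le> t} =
      (\<Union>s\<in>(SIGMA v:{..t}. {..v}). fibre E C p q (snd s) (fst s))"
    using ladder_basic(5)[OF assms] by (force simp: fibre_def antitone_maps_def)
  also have "card \<dots> = (\<Sum>s\<in>(SIGMA v:{..t}. {..v}). card (fibre E C p q (snd s) (fst s)))"
    by (intro card_UN_disjoint) (auto simp: finite_fibre[OF assms], auto simp: fibre_def)
  also have "\<dots> = (\<Sum>v\<le>t. \<Sum>u\<le>v. fibre_card n u v)"
    by (subst sum.Sigma) (auto simp: card_fibre[OF assms] split_def)
  finally show ?thesis .
qed


section \<open>The generating function of a ladder\<close>

text \<open>
  The power series \<open>1 / (1 - z)\<close>, whose powers replace the denominators of rational generating
  functions.
\<close>

definition geom :: "real fps" where "geom = Abs_fps (\<lambda>_. 1)"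

lemma geom_inverse: "(1 - fps_X) * geom = 1"
  by (rule fps_ext) (simp add: geom_def algebra_simps)

lemma fps_mult_geom_nth: "fps_nth (f * geom) n = (\<Sum>k\<le>n. fps_nth f k)"
  by (simp add: geom_def fps_mult_nth atMost_atLeast0)

lemma geom_power2_nth: "fps_nth (geom ^ 2) n = of_nat (n + 1)"
  by (simp add: power2_eq_square fps_mult_geom_nth) (simp add: geom_def)

lemma X_geom_power2_nth: "fps_nth (fps_X * geom ^ 2) n = of_nat n"
  by (cases n) (simp_all add: geom_power2_nth)

text \<open>
  The coefficients \<open>n (n + 1)\<close> arise as the product of the weight \<open>w - u + 1\<close> and the new gap
  \<open>w - v\<close> for \<open>u = v\<close>.
\<close>

lemma two_X_geom_power3_nth: "fps_nth (2 * fps_X * geom ^ 3) n = of_nat n * of_nat (n + 1)"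
proof -
  have "2 * fps_X * geom ^ 3 = fps_const 2 * ((fps_X * geom ^ 2) * geom)"
    by (simp add: power3_eq_cube power2_eq_square mult_ac numeral_fps_const)
  also have "fps_nth \<dots> n = 2 * (\<Sum>k\<le>n. of_nat k)"
    by (simp only: fps_mult_left_const_nth fps_mult_geom_nth X_geom_power2_nth)
  also have "\<dots> = of_nat n * of_nat (n + 1)"
    by (induction n) (simp_all add: algebra_simps)
  finally show ?thesis .
qed

text \<open>
  This is the series \<open>A\<^sub>n\<close> of the proof idea above. Its recurrence also involves the sums of the
  last gaps, which form the series \<open>B\<^sub>n\<close> defined next.
\<close>

definition fibre_series :: "nat \<Rightarrow> real fps" where
  "fibre_series n = Abs_fps (\<lambda>v. \<Sum>u\<le>v. of_nat (fibre_card n u v))"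

definition gap_series :: "nat \<Rightarrow> real fps" where
  "gap_series n = Abs_fps (\<lambda>v. \<Sum>u\<le>v. of_nat (v - u) * of_nat (fibre_card n u v))"

text \<open>
  Since \<open>w + 1 - u = (w - v + 1) + (v - u)\<close>, the only information on the preceding rungs that is
  needed is the number of maps and the sum of their last gaps. Both terms have the form of a
  coefficient in \<open>v\<close> times a function of \<open>w - v\<close>, so the sum over \<open>v\<close> is a convolution.
\<close>

lemma fibre_card_Suc_split:
  assumes "v \<le> w"
  shows "real (fibre_card (Suc n) v w) =
    fps_nth (fibre_series n) v * of_nat (w - v + 1) + fps_nth (gap_series n) v"
proof -
  have "real (fibre_card (Suc n) v w) =
      (\<Sum>u\<le>v. of_nat (fibre_card n u v) * (of_nat (w - v + 1) + of_nat (v - u)))"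
    using assms by (auto intro!: sum.cong simp flip: of_nat_add)
  then show ?thesis
    by (simp only: fibre_series_def gap_series_def fps_nth_Abs_fps distrib_left sum.distrib
          sum_distrib_left mult.commute)
qed

lemma fibre_series_Suc:
  "fibre_series (Suc n) = fibre_series n * geom ^ 2 + gap_series n * geom"
proof (rule fps_ext)
  fix w
  have "fps_nth (fibre_series (Suc n)) w =
      (\<Sum>v\<le>w. fps_nth (fibre_series n) v * of_nat (w - v + 1) + fps_nth (gap_series n) v)"
    by (subst fibre_series_def) (simp add: fibre_card_Suc_split del: fibre_card.simps)
  also have "\<dots> = fps_nth (fibre_series n * geom ^ 2 + gap_series n * geom) w"
    unfolding fps_add_nth fps_mult_geom_nth fps_mult_nth[of _ "geom ^ 2"] geom_power2_nth
    by (simp add: sum.distrib atMost_atLeast0)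
  finally show "fps_nth (fibre_series (Suc n)) w =
    fps_nth (fibre_series n * geom ^ 2 + gap_series n * geom) w" .
qed

lemma gap_series_Suc:
  "gap_series (Suc n) =
     fibre_series n * (2 * fps_X * geom ^ 3) + gap_series n * (fps_X * geom ^ 2)"
proof (rule fps_ext)
  fix w
  have "fps_nth (gap_series (Suc n)) w =
      (\<Sum>v\<le>w. fps_nth (fibre_series n) v * (of_nat (w - v) * of_nat (w - v + 1)) +
        fps_nth (gap_series n) v * of_nat (w - v))"
    by (subst gap_series_def)
       (simp add: fibre_card_Suc_split algebra_simps del: fibre_card.simps)
  also have "\<dots> = fps_nth (fibre_series n * (2 * fps_X * geom ^ 3) +
      gap_series n * (fps_X * geom ^ 2)) w"
    unfolding fps_add_nth fps_mult_nth[of _ "fps_X * geom ^ 2"]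
      fps_mult_nth[of _ "2 * fps_X * geom ^ 3"] X_geom_power2_nth two_X_geom_power3_nth
    by (simp add: sum.distrib atMost_atLeast0)
  finally show "fps_nth (gap_series (Suc n)) w = fps_nth (fibre_series n * (2 * fps_X * geom ^ 3) +
      gap_series n * (fps_X * geom ^ 2)) w" .
qed

lemma fibre_series_0: "fibre_series 0 = geom ^ 2"
  by (rule fps_ext) (simp add: geom_power2_nth, simp add: fibre_series_def)

lemma gap_series_0: "gap_series 0 = fps_X * geom ^ 3"
proof (rule fps_ext)
  fix v
  have "(\<Sum>u\<le>v. real (v - u)) = (\<Sum>u\<le>v. real u)"
    by (rule sum.reindex_bij_witness[of _ "\<lambda>u. v - u" "\<lambda>u. v - u"]) auto
  moreover have "fps_X * geom ^ 3 = (fps_X * geom ^ 2) * geom"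
    by (simp add: power3_eq_cube power2_eq_square mult_ac)
  ultimately show "fps_nth (gap_series 0) v = fps_nth (fps_X * geom ^ 3) v"
    by (simp only: fps_mult_geom_nth X_geom_power2_nth) (simp add: gap_series_def)
qed

text \<open>
  The numerator of the gap series is the difference of two consecutive antidiagonal polynomials:
  by \<open>fibre_series_Suc\<close>, it is what takes the numerator of one fibre series to that of the next.
  Both claims must be proved together, and the step for the gap series is the recurrence
  \<open>delannoy_poly_rec\<close>.
\<close>

lemma fibre_gap_series_eq:
  "fibre_series n = fps_of_poly (delannoy_poly n) * geom ^ (2 * n + 2) \<and>
   gap_series n =
     fps_of_poly (delannoy_poly (Suc n) - delannoy_poly n) * geom ^ (2 * n + 3)"
proof (induction n)
  case 0
  show ?case
    by (simp add: fibre_series_0 gap_series_0 delannoy_poly_0 delannoy_poly_1 one_pCons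
          fps_of_poly_pCons power2_eq_square)
next
  case (Suc n)
  have rec: "fps_of_poly (delannoy_poly (Suc (Suc n))) =
      (1 + fps_X) * fps_of_poly (delannoy_poly (Suc n)) + fps_X * fps_of_poly (delannoy_poly n)"
    by (simp add: delannoy_poly_rec fps_of_poly_add fps_of_poly_mult fps_of_poly_pCons
          del: mult_pCons_left)
  have pow: "geom ^ (2 * n + 3) = geom ^ (2 * n + 2) * geom"
      "geom ^ (2 * Suc n + 2) = geom ^ (2 * n + 2) * geom ^ 2"
      "geom ^ (2 * Suc n + 3) = geom ^ (2 * n + 2) * geom ^ 3"
    by (simp_all add: numeral_eq_Suc mult_ac)
  show ?case
    unfolding fibre_series_Suc gap_series_Suc Suc.IH[THEN conjunct1] Suc.IH[THEN conjunct2]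
      fps_of_poly_diff rec pow
    by (intro conjI) algebra+
qed


section \<open>Counting lattice points of a dilated order polytope\<close>

text \<open>
  The order polytope is defined by the full order, while the ladder records a generating relation;
  transitivity of the order on the values makes the two sets of inequalities equivalent.
\<close>

lemma trancl_monotone_iff:
  "(\<forall>(i, j)\<in>C\<^sup>+. x i \<le> (x j :: 'b :: preorder)) \<longleftrightarrow> (\<forall>(i, j)\<in>C. x i \<le> x j)"
proof
  assume C: "\<forall>(i, j)\<in>C. x i \<le> x j"
  have "x i \<le> x j" if "(i, j) \<in> C\<^sup>+" for i j
    using that by (induction rule: trancl_induct) (use C order_trans in fast)+
  then show "\<forall>(i, j)\<in>C\<^sup>+. x i \<le> x j" by blast
qed (use r_into_trancl in fast)

lemma order_polytope_trancl:
  assumes "C \<subseteq> A \<times> A"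
  shows "order_polytope A (C\<^sup>+) = {x \<in> A \<rightarrow>\<^sub>E {0..1}. \<forall>(i, j)\<in>C. x i \<le> x j}"
proof -
  have "C\<^sup>+ \<subseteq> A \<times> A" using assms by (rule trancl_subset_Sigma)
  then have "(\<forall>i\<in>A. \<forall>j\<in>A. (i, j) \<in> C\<^sup>+ \<longrightarrow> x i \<le> x j) \<longleftrightarrow> (\<forall>(i, j)\<in>C. x i \<le> x j)"
    for x :: "nat \<Rightarrow> real"
    by (subst trancl_monotone_iff[of C x, symmetric]) blast
  then show ?thesis
    unfolding order_polytope_def by simp
qed

lemma dilate_order_polytope:
  assumes "C \<subseteq> A \<times> A"
  shows "dilate A t (order_polytope A (C\<^sup>+)) =
    {y \<in> A \<rightarrow>\<^sub>E {0..of_nat t}. \<forall>(i, j)\<in>C. y i \<le> y j}" (is "_ = ?D")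
proof (intro equalityI subsetI)
  fix y assume "y \<in> dilate A t (order_polytope A (C\<^sup>+))"
  then obtain x where x: "x \<in> A \<rightarrow>\<^sub>E {0..1}" "\<And>i j. (i, j) \<in> C \<Longrightarrow> x i \<le> x j"
    and y: "y = (\<lambda>i\<in>A. of_nat t * x i)"
    unfolding dilate_def order_polytope_trancl[OF assms] by blast
  have "y i \<le> y j" if "(i, j) \<in> C" for i j
    using that x(2)[OF that] assms by (auto simp: y intro!: mult_left_mono)
  moreover have "y \<in> A \<rightarrow>\<^sub>E {0..of_nat t}"
    using x(1) by (auto simp: y PiE_iff mult_left_le)
  ultimately show "y \<in> ?D" by blast
next
  fix y assume y: "y \<in> ?D"
  define x where "x = (\<lambda>i\<in>A. y i / of_nat t)"
  \<comment> \<open>For \<open>t = 0\<close> the dilate is the origin; both \<open>y\<close> and, as division by 0 yields 0, \<open>x\<close> vanish.\<close>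
  have "y i = 0" if "t = 0" "i \<in> A" for i using y that by (auto simp: PiE_iff)
  then have "y = (\<lambda>i\<in>A. of_nat t * x i)"
    using y by (cases "t = 0") (auto simp: x_def fun_eq_iff PiE_iff extensional_def)
  moreover have "x i \<le> x j" if "(i, j) \<in> C" for i j
    using that y assms by (auto simp: x_def intro!: divide_right_mono)
  moreover have "x \<in> A \<rightarrow>\<^sub>E {0..1}"
    using y by (auto simp: x_def PiE_iff divide_le_eq_1)
  ultimately show "y \<in> dilate A t (order_polytope A (C\<^sup>+))"
    unfolding dilate_def order_polytope_trancl[OF assms] by blast
qed

text \<open>
  The reflection \<open>y \<mapsto> t - y\<close> is used instead of the identity, because the snake grows downwards
  and the counting along the chain needs the last element to carry the largest value.
\<close>

lemma card_lattice_points: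
  fixes A :: "nat set"
  assumes "C \<subseteq> A \<times> A"
  shows "card (dilate A t (order_polytope A (C\<^sup>+)) \<inter> (A \<rightarrow>\<^sub>E \<int>)) =
    card {g \<in> antitone_maps A C. \<forall>i\<in>A. g i \<le> t}"
proof -
  let ?G = "{g \<in> antitone_maps A C. \<forall>i\<in>A. g i \<le> t}"
  let ?Y = "{y \<in> A \<rightarrow>\<^sub>E {0..of_nat t}. \<forall>(i, j)\<in>C. y i \<le> y j} \<inter> (A \<rightarrow>\<^sub>E (\<int> :: real set))"
  have "bij_betw (\<lambda>g. \<lambda>i\<in>A. real t - real (g i)) ?G ?Y"
  proof (rule bij_betw_byWitness[where f' = "\<lambda>y. \<lambda>i\<in>A. nat \<lfloor>real t - y i\<rfloor>"])
    show "\<forall>g\<in>?G. (\<lambda>i\<in>A. nat \<lfloor>real t - (\<lambda>i\<in>A. real t - real (g i)) i\<rfloor>) = g"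
      by (auto simp: antitone_maps_def PiE_iff extensional_def fun_eq_iff)
    show "\<forall>y\<in>?Y. (\<lambda>i\<in>A. real t - real ((\<lambda>i\<in>A. nat \<lfloor>real t - y i\<rfloor>) i)) = y"
      by (auto simp: PiE_iff extensional_def fun_eq_iff elim!: Ints_cases)
    show "(\<lambda>g. \<lambda>i\<in>A. real t - real (g i)) ` ?G \<subseteq> ?Y"
    proof safe
      fix g i j assume "(i, j) \<in> C" "g \<in> antitone_maps A C"
      moreover from this have "g j \<le> g i" "i \<in> A" "j \<in> A"
        using assms by (auto simp: antitone_maps_def)
      ultimately show "(\<lambda>i\<in>A. real t - real (g i)) i \<le> (\<lambda>i\<in>A. real t - real (g i)) j"
        by simp
    qed (auto simp: PiE_iff)
    show "(\<lambda>y. \<lambda>i\<in>A. nat \<lfloor>real t - y i\<rfloor>) ` ?Y \<subseteq> ?G"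
    proof safe
      fix y :: "nat \<Rightarrow> real" assume y: "\<forall>(i, j)\<in>C. y i \<le> y j"
      have "nat \<lfloor>real t - y j\<rfloor> \<le> nat \<lfloor>real t - y i\<rfloor>" if "(i, j) \<in> C" for i j
        using y that by (intro nat_mono floor_mono) auto
      then show "(\<lambda>i\<in>A. nat \<lfloor>real t - y i\<rfloor>) \<in> antitone_maps A C"
        using assms by (auto simp: antitone_maps_def)
    next
      fix y :: "nat \<Rightarrow> real" and i assume "y \<in> A \<rightarrow>\<^sub>E {0..real t}" "i \<in> A"
      then have "\<lfloor>real t - y i\<rfloor> \<le> \<lfloor>real t\<rfloor>" by (intro floor_mono) (auto simp: PiE_iff)
      with \<open>i \<in> A\<close> show "(\<lambda>i\<in>A. nat \<lfloor>real t - y i\<rfloor>) i \<le> t" by simp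
    qed
  qed
  then show ?thesis
    unfolding dilate_order_polytope[OF assms] by (simp add: bij_betw_same_card)
qed

lemma ehrhart_series_ladder:
  assumes "ladder n E C p q"
  shows "ehrhart_series E (order_polytope E (C\<^sup>+)) =
    fps_of_poly (delannoy_poly n) * geom ^ (card E + 1)"
proof -
  have "ehrhart_series E (order_polytope E (C\<^sup>+)) = fibre_series n * geom"
  proof (rule fps_ext)
    fix t
    have "g \<in> antitone_maps E C \<Longrightarrow> (\<forall>i\<in>E. g i \<le> t) \<longleftrightarrow> g q \<le> t" for g
      using antitone_maps_le_last[OF assms] ladder_basic(4)[OF assms] le_trans
      unfolding antitone_maps_def by blast
    then have "{g \<in> antitone_maps E C. \<forall>i\<in>E. g i \<le> t} = {g \<in> antitone_maps E C. g q \<le> t}"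
      by blast
    then show "fps_nth (ehrhart_series E (order_polytope E (C\<^sup>+))) t = fps_nth (fibre_series n * geom) t"
      by (simp add: ehrhart_series_def card_lattice_points[OF ladder_basic(2)[OF assms]]
            card_antitone_maps_bounded[OF assms] fps_mult_geom_nth fibre_series_def)
  qed
  then show ?thesis
    by (simp add: fibre_gap_series_eq ladder_basic(6)[OF assms] mult_ac)
qed


section \<open>Regular snake posets are ladders\<close>

definition alternating_word :: "letter \<Rightarrow> nat \<Rightarrow> snake_word" where
  "alternating_word x m =
     map (\<lambda>i. if even i then x else if x = L then R else L) [0..<m]"

lemma length_alternating_word [simp]: "length (alternating_word x m) = m"
  by (simp add: alternating_word_def)

lemma regular_snake_word_alternating:
  assumes "regular_snake_word w"
  obtains x where "w = alternating_word x (length w)"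
proof -
  from assms have "w = alternating_word L (length w) \<or> w = alternating_word R (length w)"
    by (auto simp: regular_snake_word_def alternating_word_def intro!: nth_equalityI)
  then show ?thesis using that by blast
qed

text \<open>
  The label of the last but one element of the chain after \<open>m\<close> letters. In the diamond of the empty word the two
  middle elements are interchangeable; the first letter decides which of them carries on the chain.
\<close>

definition penultimate :: "letter \<Rightarrow> nat \<Rightarrow> nat" where
  "penultimate x m = (if m = 0 then if x = L then 1 else 2 else 2 * m + 1)"

text \<open>
  In an alternating word any two consecutive letters differ, so from the second letter on the
  element \<open>2 n + 2\<close> that the \<open>n\<close>-th letter adds is placed below \<open>2 n - 1\<close>, the element of the chain two steps above the
  new end \<open>2 n + 3\<close>.
\<close>

lemma snake_covers_alternating_Suc:
  "snake_covers (alternating_word x (Suc m)) =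
     insert (2 * m + 5, 2 * m + 3) (insert (2 * m + 5, 2 * m + 4)
       (insert (2 * m + 4, penultimate x m) (snake_covers (alternating_word x m))))"
proof -
  have but: "butlast (alternating_word x (Suc m)) = alternating_word x m"
    by (simp add: alternating_word_def)
  have len: "alternating_word x (Suc m) \<noteq> []"
    by (simp add: alternating_word_def)
  have lst: "alternating_word x (Suc m) ! m = (if even m then x else if x = L then R else L)"
    by (simp add: alternating_word_def nth_append)
  have prev: "alternating_word x (Suc m) ! (m - 1) =
      (if even m then if x = L then R else L else x)" if "m \<noteq> 0"
    using that by (simp add: alternating_word_def nth_append)
  show ?thesis
  proof (cases "m = 0")
    case True
    then show ?thesis
      by (subst snake_covers.simps, cases x)
         (use len but lst in \<open>auto simp: Let_def penultimate_def\<close>)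
  next
    case False
    then show ?thesis
      by (subst snake_covers.simps, cases x)
         (use len but lst prev in \<open>auto simp: Let_def penultimate_def\<close>)
  qed
qed

text \<open>
  The chain is \<open>0 \<succ> p \<succ> 3 \<succ> 5 \<succ> \<dots>\<close>, where \<open>p\<close> is the middle element of the diamond to which the
  first letter attaches the element 4. The other middle element is the free element of the first
  rung; afterwards the even labels are the free elements.
\<close>

lemma ladder_alternating_word:
  "ladder (Suc m) (snake_elems (alternating_word x m)) (snake_covers (alternating_word x m))
     (penultimate x m) (2 * m + 3)"
proof (induction m)
  case 0
  (* Since p is 1 or 2, q is the other one of these two elements. *)
  define p q :: nat where "p = penultimate x 0" and "q = 3 - p"
  have "ladder (Suc 0) (insert 3 (insert q {0, p}))
      (insert (3, p) (insert (3, q) (insert (q, 0) {(p, 0)}))) p 3"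
    by (intro ladder.intros) (auto simp: p_def q_def penultimate_def)
  moreover have "insert 3 (insert q {0, p}) = snake_elems (alternating_word x 0)"
    by (subst snake_elems.simps)
       (auto simp: alternating_word_def p_def q_def penultimate_def split: if_splits)
  moreover have "insert (3, p) (insert (3, q) (insert (q, 0) {(p, 0)})) =
      snake_covers (alternating_word x 0)"
    by (subst snake_covers.simps)
       (auto simp: alternating_word_def p_def q_def penultimate_def split: if_splits)
  ultimately show ?case by (simp add: p_def)
next
  case (Suc m)
  have "snake_elems (alternating_word x (Suc m)) =
      insert (2 * m + 5) (insert (2 * m + 4) (snake_elems (alternating_word x m)))"
    by (auto simp: snake_elems_eq)
  moreover have "ladder (Suc (Suc m))
      (insert (2 * m + 5) (insert (2 * m + 4) (snake_elems (alternating_word x m))))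
      (snake_covers (alternating_word x (Suc m))) (2 * m + 3) (2 * m + 5)"
    unfolding snake_covers_alternating_Suc
    by (rule ladder.rung[OF Suc.IH]) (auto simp: snake_elems_eq)
  moreover have "2 * Suc m + 3 = 2 * m + 5" "penultimate x (Suc m) = 2 * m + 3"
    by (simp_all add: penultimate_def)
  ultimately show ?case by (simp only:)
qed


section \<open>The h-star polynomial\<close>

text \<open>
  Both the division in the definition and the uniqueness needed for the description operator come
  from \<open>1 - z\<close> being invertible in the ring of power series.
\<close>

lemma h_star_eqI:
  assumes "ehrhart_series (snake_elems w) (order_polytope (snake_elems w) (snake_less w)) =
    fps_of_poly h * geom ^ (card (snake_elems w) + 1)"
  shows "h_star w = h"
proof -
  have cancel: "f / (1 - fps_X) ^ k = f * geom ^ k" for f :: "real fps" and k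
  proof -
    have "(1 - fps_X) ^ k * geom ^ k = 1"
      by (simp add: geom_inverse flip: power_mult_distrib)
    then have "f = f * geom ^ k * (1 - fps_X) ^ k"
      by (simp add: mult_ac)
    moreover have "(1 - fps_X) ^ k \<noteq> (0 :: real fps)"
      using \<open>(1 - fps_X) ^ k * geom ^ k = 1\<close> by auto
    ultimately show ?thesis
      by (metis nonzero_mult_div_cancel_right)
  qed
  have "geom \<noteq> 0" using geom_inverse by auto
  then show ?thesis
    unfolding h_star_def cancel assms by (intro the_equality) auto
qed

theorem theorem4p8:
  fixes n :: nat and w :: snake_word
  assumes "n \<ge> 1" and "length w = n - 1" and "regular_snake_word w"
  shows "h_star w = (\<Sum>i = 0..n. monom (of_nat (delannoy (n - i) i)) i)"
proof -
  obtain x where w: "w = alternating_word x (n - 1)"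
    using assms(2,3) regular_snake_word_alternating by metis
  have "ladder n (snake_elems w) (snake_covers w) (penultimate x (n - 1)) (2 * n + 1)"
    using ladder_alternating_word[of "n - 1" x] assms(1) by (simp add: w algebra_simps)
  then show ?thesis
    unfolding delannoy_poly_def[symmetric]
    by (intro h_star_eqI) (simp only: snake_less_def ehrhart_series_ladder)
qed

end
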